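(* Let $a,b\in\mathrm{Aut}(T)$ be finite-state automorphisms with finite orbit-signalizers $\mathrm{OS}(a)$, $\mathrm{OS}(b)$. Then $a$ and $b$ are conjugate in $\mathrm{Aut}(T)$ if and only if they are conjugate in the group $\mathrm{RAut}(T)$ of functionally recursive automorphisms, if and only if the conjugator graph $\Psi(a,b)$ is nonempty.
   Context: Let $X=\{1,2,\ldots,q\}$ and let $T$ be the regular rooted $q$-ary tree whose vertices are the words in $X^*$. $\mathrm{Aut}(T)$ is the group of automorphisms of $T$ as a rooted tree, acting on the right ($v^{gh}=(v^g)^h$). For $g\in\mathrm{Aut}(T)$ and $v\in X^*$, the state $g|_v\in\mathrm{Aut}(T)$ is the unique automorphism with $(vw)^g=v^g\,w^{g|_v}$ for all $w\in X^*$. Write $g=(g|_1,\ldots,g|_q)\pi_g$, where $\pi_g\in\mathrm{Sym}(X)$ is the permutation of $X$ induced by $g$. An automorphism $g$ is finite-state if $\{g|_v:v\in X^*\}$ is finite. Functionally recursive automorphisms: a finite set $\{g_1,\ldots,g_m\}\subset\mathrm{Aut}(T)$ is functionally recursive if there are words $w_{ij}$ over $\{g_1^{\pm1},\ldots,g_m^{\pm1}\}$ and permutations $\pi_i\in\mathrm{Sym}(X)$ with $g_i=(w_{i1},\ldots,w_{iq})\pi_i$ for all $i$. An automorphism is functionally recursive if it belongs to some functionally recursive set; these automorphisms form the group $\mathrm{RAut}(T)$. Orbit-signalizer: $\mathrm{OS}(a)=\{a^m|_v : v\in X^*,\ m=|\mathrm{Orb}_a(v)|\}$, where $\mathrm{Orb}_a(v)$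 is the orbit of $v$ under the action of $a$. For $c,d\in\mathrm{Aut}(T)$ let $\mathrm{C}\Pi(c,d)=\{\pi\in\mathrm{Sym}(X):\pi^{-1}\pi_c\pi=\pi_d\}$ (possibly empty). Conjugator graph $\Psi(a,b)$: start with the directed labeled graph whose vertices are the triples $(c,d,\pi)$ with $c\in\mathrm{OS}(a)$, $d\in\mathrm{OS}(b)$, $\pi\in\mathrm{C}\Pi(c,d)$ (whenever this last set is nonempty). For a vertex $(c,d,\pi)$ let $\mathcal O_1,\ldots,\mathcal O_k$ be the orbits of $c$ on $X$, let $x_i$ be the least element of $\mathcal O_i$ and $m_i=|\mathcal O_i|$. If one of the sets $\mathrm{C}\Pi(c^{m_i}|_{x_i},d^{m_i}|_{x_i^\pi})$ is empty, then $(c,d,\pi)$ is a dead vertex (it has no outgoing edges); otherwise, for every $i=1,\ldots,k$ and every $\tau\in\mathrm{C}\Pi(c^{m_i}|_{x_i},d^{m_i}|_{x_i^\pi})$ there is an edge labeled $x_i$ from $(c,d,\pi)$ to $(c^{m_i}|_{x_i},d^{m_i}|_{x_i^\pi},\tau)$. Then simplify this graph: remove each vertex $(c,d,\pi)$ which has no outgoing edge labeled $x_i$ for some $i\in\{1,\dots,k\}$ (with the $x_i$ computed for that $c$), together with all edges leading to it, and repeat these reductions as long as possible. The resulting graph is $\Psi(a,b)$.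
   Formalization: "Ψ(a,b) is nonempty" is replaced by "Ψ(a,b) contains a vertex (a,b,π)"; as literally stated the claim fails, e.g. q=2, a=(1,1)(1 2), b=1, where the vertices (1,1,π) survive although a and b are not conjugate. *)

theory Defs
  imports
    "HOL-Algebra.Group"
    "HOL-Combinatorics.Orbits"
    "HOL-Library.While_Combinator"
    "Graph_Theory.Digraph_Component"
begin

section \<open>The regular rooted tree and its automorphism group\<close>

text \<open>
  The alphabet \<open>X = {1, ..., q}\<close> is the universe of a finite linearly ordered type \<open>'x\<close>, so that
  the vertices of the tree \<open>T\<close> are the lists over \<open>'x\<close>, and \<open>q\<close> is the cardinality of \<open>'x\<close>.
  Tree automorphisms act on the right: \<open>v\<^sup>g\<close> is rendered as \<open>g v\<close>.
\<close>

definition tree_adj :: "'x list \<Rightarrow> 'x list \<Rightarrow> bool" where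
  "tree_adj u v \<longleftrightarrow> (\<exists>x. v = u @ [x] \<or> u = v @ [x])"

definition tree_auts :: "('x list \<Rightarrow> 'x list) set" where
  "tree_auts = {g. bij g \<and> g [] = [] \<and> (\<forall>u v. tree_adj (g u) (g v) \<longleftrightarrow> tree_adj u v)}"

text \<open>Because of the right action, the product \<open>g h\<close> first applies \<open>g\<close> and then \<open>h\<close>.\<close>

definition Aut_T :: "('x list \<Rightarrow> 'x list) monoid" where
  "Aut_T = \<lparr>carrier = tree_auts, monoid.mult = (\<lambda>g h. h \<circ> g), one = id\<rparr>"

text \<open>
  For a tree automorphism \<open>g\<close>, \<open>state g v\<close> is the state \<open>g|\<^sub>v\<close>, see \<open>state_unique\<close> and
  \<open>state_in_Aut_T\<close>, and \<open>root_perm g\<close> is \<open>\<pi>\<^sub>g\<close>.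
\<close>

definition state :: "('x list \<Rightarrow> 'x list) \<Rightarrow> 'x list \<Rightarrow> 'x list \<Rightarrow> 'x list" where
  "state g v = (\<lambda>w. drop (length v) (g (v @ w)))"

definition root_perm :: "('x list \<Rightarrow> 'x list) \<Rightarrow> 'x \<Rightarrow> 'x" where
  "root_perm g = (\<lambda>x. hd (g [x]))"

text \<open>\<open>wreath f \<pi>\<close> is the map \<open>(f\<^sub>1, ..., f\<^sub>q)\<pi>\<close>.\<close>

fun wreath :: "('x \<Rightarrow> 'x list \<Rightarrow> 'x list) \<Rightarrow> ('x \<Rightarrow> 'x) \<Rightarrow> 'x list \<Rightarrow> 'x list" where
  "wreath f \<pi> [] = []"
| "wreath f \<pi> (x # w) = \<pi> x # f x w"

definition finite_state :: "('x list \<Rightarrow> 'x list) \<Rightarrow> bool" where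
  "finite_state g \<longleftrightarrow> finite (range (state g))"


section \<open>Functionally recursive automorphisms\<close>

definition word_value :: "('a, 'b) monoid_scheme \<Rightarrow> 'a list \<Rightarrow> 'a" where
  "word_value G ws = foldr (monoid.mult G) ws \<one>\<^bsub>G\<^esub>"

definition functionally_recursive_set :: "('x list \<Rightarrow> 'x list) set \<Rightarrow> bool" where
  "functionally_recursive_set S \<longleftrightarrow>
     finite S \<and> S \<subseteq> carrier Aut_T \<and>
     (\<forall>g\<in>S. \<exists>w \<pi>. (\<forall>x. w x \<in> lists (S \<union> m_inv Aut_T ` S)) \<and> bij \<pi> \<and>
        g = wreath (\<lambda>x. word_value Aut_T (w x)) \<pi>)"

definition RAut_T :: "('x list \<Rightarrow> 'x list) monoid" where
  "RAut_T = Aut_T\<lparr>carrier := {g. \<exists>S. functionally_recursive_set S \<and> g \<in> S}\<rparr>"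

definition conjugate_in :: "('a, 'b) monoid_scheme \<Rightarrow> 'a \<Rightarrow> 'a \<Rightarrow> bool" where
  "conjugate_in G a b \<longleftrightarrow> a \<in> carrier G \<and> b \<in> carrier G \<and>
     (\<exists>h\<in>carrier G. inv\<^bsub>G\<^esub> h \<otimes>\<^bsub>G\<^esub> a \<otimes>\<^bsub>G\<^esub> h = b)"


section \<open>Orbit-signalizers and the conjugator graph\<close>

definition orbit_signalizer :: "('x list \<Rightarrow> 'x list) \<Rightarrow> ('x list \<Rightarrow> 'x list) set" where
  "orbit_signalizer a = {state (a ^^ card (orbit a v)) v | v. True}"

text \<open>\<open>\<pi>\<inverse> \<pi>\<^sub>c \<pi> = \<pi>\<^sub>d\<close> in the right-action convention:\<close>

definition conj_perms :: "('x list \<Rightarrow> 'x list) \<Rightarrow> ('x list \<Rightarrow> 'x list) \<Rightarrow> ('x \<Rightarrow> 'x) set" where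
  "conj_perms c d = {\<pi>. bij \<pi> \<and> \<pi> \<circ> root_perm c \<circ> inv_into UNIV \<pi> = root_perm d}"

text \<open>\<open>orbit_reps c\<close> is the set of the \<open>x\<^sub>i\<close>, and \<open>orbit_size c x\<^sub>i\<close> is \<open>m\<^sub>i\<close>.\<close>

definition orbit_reps :: "('x::{finite,linorder} list \<Rightarrow> 'x list) \<Rightarrow> 'x set" where
  "orbit_reps c = Min ` range (orbit (root_perm c))"

definition orbit_size :: "('x list \<Rightarrow> 'x list) \<Rightarrow> 'x \<Rightarrow> nat" where
  "orbit_size c x = card (orbit (root_perm c) x)"

type_synonym 'x vertex = "('x list \<Rightarrow> 'x list) \<times> ('x list \<Rightarrow> 'x list) \<times> ('x \<Rightarrow> 'x)"

text \<open>
  An arc is a triple of its tail, its label and its head. The successor pair of \<open>(c, d, \<pi>)\<close> at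
  \<open>x\<close> is \<open>(c\<^sup>m|\<^sub>x, d\<^sup>m|\<^sub>y)\<close> with \<open>y = x\<^sup>\<pi>\<close> and \<open>m\<close> the size of the orbit of \<open>x\<close> under \<open>c\<close>.
\<close>

fun succ_pair :: "'x vertex \<Rightarrow> 'x \<Rightarrow> ('x list \<Rightarrow> 'x list) \<times> ('x list \<Rightarrow> 'x list)" where
  "succ_pair (c, d, \<pi>) x =
     (state (c ^^ orbit_size c x) [x], state (d ^^ orbit_size c x) [\<pi> x])"

definition dead_vertex :: "'x::{finite,linorder} vertex \<Rightarrow> bool" where
  "dead_vertex u \<longleftrightarrow>
     (\<exists>x\<in>orbit_reps (fst u). conj_perms (fst (succ_pair u x)) (snd (succ_pair u x)) = {})"

definition initial_graph ::
  "('x::{finite,linorder} list \<Rightarrow> 'x list) \<Rightarrow> ('x list \<Rightarrow> 'x list) \<Rightarrow>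
     ('x vertex, 'x vertex \<times> 'x \<times> 'x vertex) pre_digraph" where
  "initial_graph a b =
     (let V = {(c, d, \<pi>). c \<in> orbit_signalizer a \<and> d \<in> orbit_signalizer b \<and> \<pi> \<in> conj_perms c d}
      in \<lparr>verts = V,
          arcs = {(u, x, (c', d', \<tau>)) | u x c' d' \<tau>.
                    u \<in> V \<and> \<not> dead_vertex u \<and> x \<in> orbit_reps (fst u) \<and>
                    (c', d') = succ_pair u x \<and> \<tau> \<in> conj_perms c' d'},
          tail = fst, head = snd \<circ> snd\<rparr>)"

definition prune ::
  "('x::{finite,linorder} vertex, 'x vertex \<times> 'x \<times> 'x vertex) pre_digraph \<Rightarrow>
     ('x vertex, 'x vertex \<times> 'x \<times> 'x vertex) pre_digraph" where
  "prune G = induce_subgraph G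
     {u \<in> verts G. \<forall>x\<in>orbit_reps (fst u). \<exists>e\<in>arcs G. tail G e = u \<and> fst (snd e) = x}"

text \<open>
  If both orbit-signalizers are finite, then the initial graph has finitely many vertices and the
  reduction terminates. The initial graph contains all pairs from the two orbit-signalizers, so a
  vertex \<open>(c, d, \<pi>)\<close> of the reduced graph only witnesses that \<open>c\<close> and \<open>d\<close> are conjugate. For the
  pair \<open>a\<close>, \<open>b\<close> itself the relevant question is whether some vertex \<open>(a, b, \<pi>)\<close> survives: if \<open>a\<close>
  only swaps two first letters and \<open>b\<close> is trivial, then the vertices \<open>(id, id, \<pi>)\<close> survive although
  \<open>a\<close> and \<open>b\<close> are not conjugate.
\<close>

definition conjugator_graph ::
  "('x::{finite,linorder} list \<Rightarrow> 'x list) \<Rightarrow> ('x list \<Rightarrow> 'x list) \<Rightarrow>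
     ('x vertex, 'x vertex \<times> 'x \<times> 'x vertex) pre_digraph" where
  "conjugator_graph a b = while (\<lambda>G. prune G \<noteq> G) prune (initial_graph a b)"


section \<open>Basic facts\<close>

lemma tree_auts_snoc:
  assumes g: "g \<in> tree_auts"
  shows "\<exists>y. g (v @ [x]) = g v @ [y]"
proof (induction v arbitrary: x rule: rev_induct)
  case Nil
  have root: "g [] = []" and "tree_adj (g []) (g [x]) \<longleftrightarrow> tree_adj [] [x]"
    using g unfolding tree_auts_def by blast+
  then have "tree_adj [] (g [x])"
    by (simp add: tree_adj_def)
  then show ?case
    by (simp add: tree_adj_def root)
next
  case (snoc z u)
  have inj: "inj g" using g by (auto simp: tree_auts_def bij_def)
  obtain y where y: "g (u @ [z]) = g u @ [y]" using snoc by blast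
  have "tree_adj (g (u @ [z])) (g ((u @ [z]) @ [x]))"
    using g by (simp add: tree_auts_def) (simp add: tree_adj_def)
  then consider t where "g ((u @ [z]) @ [x]) = g (u @ [z]) @ [t]"
    | t where "g (u @ [z]) = g ((u @ [z]) @ [x]) @ [t]"
    unfolding tree_adj_def by blast
  then show ?case
  proof cases
    case 2
    then have "g u = g ((u @ [z]) @ [x])" using y by simp
    then have "u = (u @ [z]) @ [x]" using inj by (simp only: inj_eq)
    then show ?thesis by simp
  qed blast
qed

lemma tree_auts_append:
  assumes g: "g \<in> tree_auts"
  shows "g (v @ w) = g v @ state g v w" and "length (g v) = length v"
proof -
  have len: "length (g v) = length v" for v
  proof (induction v rule: rev_induct)
    case Nil
    then show ?case using g by (simp add: tree_auts_def)
  next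
    case (snoc x v)
    then show ?case using tree_auts_snoc[OF g, of v x] by auto
  qed
  have "\<exists>t. g (v @ w) = g v @ t"
  proof (induction w rule: rev_induct)
    case (snoc x w)
    then show ?case using tree_auts_snoc[OF g, of "v @ w" x] by auto
  qed simp
  then show "g (v @ w) = g v @ state g v w"
    using len[of v] by (auto simp: state_def)
  show "length (g v) = length v" by (fact len)
qed

lemma tree_auts_comp: "g \<in> tree_auts \<Longrightarrow> h \<in> tree_auts \<Longrightarrow> h \<circ> g \<in> tree_auts"
  by (auto simp: tree_auts_def intro: bij_comp)

lemma tree_auts_inv:
  assumes "g \<in> tree_auts"
  shows "inv_into UNIV g \<in> tree_auts"
proof -
  have bij: "bij g" and root: "g [] = []"
    and adj: "\<And>u v. tree_adj (g u) (g v) \<longleftrightarrow> tree_adj u v"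
    using assms by (auto simp: tree_auts_def)
  have "tree_adj (inv_into UNIV g u) (inv_into UNIV g v) \<longleftrightarrow> tree_adj u v" for u v
    using adj[of "inv_into UNIV g u" "inv_into UNIV g v"] bij by (simp add: bij_is_surj surj_f_inv_f)
  moreover have "inv_into UNIV g [] = []"
    using bij root by (metis bij_inv_eq_iff)
  ultimately show ?thesis
    using bij by (simp add: tree_auts_def bij_imp_bij_inv)
qed

lemma group_Aut_T: "group (Aut_T :: ('x list \<Rightarrow> 'x list) monoid)"
proof (rule groupI)
  fix g :: "'x list \<Rightarrow> 'x list"
  assume g: "g \<in> carrier Aut_T"
  then have "g \<circ> inv_into UNIV g = id"
    using surj_iff[of g] by (auto simp: Aut_T_def tree_auts_def bij_def)
  then show "\<exists>h\<in>carrier Aut_T. h \<otimes>\<^bsub>Aut_T\<^esub> g = \<one>\<^bsub>Aut_T\<^esub>"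
    using g tree_auts_inv[of g] by (auto simp: Aut_T_def)
qed (auto simp: Aut_T_def comp_assoc tree_auts_comp, auto simp: tree_auts_def)

lemma state_in_Aut_T:
  assumes "g \<in> carrier Aut_T"
  shows "state g v \<in> carrier Aut_T"
proof -
  have g: "g \<in> tree_auts" using assms by (simp add: Aut_T_def)
  have bij: "bij g" using g by (simp add: tree_auts_def)
  note app = tree_auts_append(1)[OF g, of v] and len = tree_auts_append(2)[OF g]
  have "inj (state g v)"
  proof (rule injI)
    fix s t assume "state g v s = state g v t"
    then have "g (v @ s) = g (v @ t)" by (simp add: app)
    then show "s = t" using bij by (simp add: bij_def inj_eq)
  qed
  moreover have "surj (state g v)"
  proof (rule surjI)
    fix t
    let ?u = "inv_into UNIV g (g v @ t)"
    have u: "g ?u = g v @ t" using bij by (simp add: bij_is_surj surj_f_inv_f)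
    have lu: "length ?u = length v + length t"
      using len[of ?u] len[of v] u by simp
    define p s where "p = take (length v) ?u" and "s = drop (length v) ?u"
    have ps: "?u = p @ s" and "length p = length v"
      using lu by (simp_all add: p_def s_def)
    then have "g p = g v"
      using u tree_auts_append(1)[OF g, of p s] len[of p] len[of v] by simp
    then have "p = v" using bij by (simp add: bij_def inj_eq)
    then show "state g v (drop (length v) (inv_into UNIV g (g v @ t))) = t"
      using u ps app[of s] by (metis s_def same_append_eq)
  qed
  moreover have "state g v [] = []"
    using len[of v] by (simp add: state_def)
  moreover have "tree_adj (state g v s) (state g v t) \<longleftrightarrow> tree_adj s t" for s t
  proof -
    have shift: "tree_adj (p @ s) (p @ t) \<longleftrightarrow> tree_adj s t" for p s t :: "'a list"
      by (simp add: tree_adj_def)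
    have "tree_adj (g (v @ s)) (g (v @ t)) \<longleftrightarrow> tree_adj (v @ s) (v @ t)"
      using g by (simp add: tree_auts_def)
    then show ?thesis by (simp add: app shift)
  qed
  ultimately show ?thesis by (simp add: Aut_T_def tree_auts_def bij_def)
qed

lemma state_unique:
  assumes "g \<in> carrier Aut_T"
  shows "(\<forall>w. g (v @ w) = g v @ h w) \<longleftrightarrow> h = state g v"
  using assms tree_auts_append(1)[of g v] by (auto simp: Aut_T_def fun_eq_iff)

end

theory Submission
  imports Defs "HOL-Algebra.Generated_Groups"
begin

text \<open>
  Read from the root, an equation \<open>h\<inverse> a h = b\<close> says that the root permutation of \<open>h\<close> conjugates
  \<open>\<pi>\<^sub>a\<close> to \<open>\<pi>\<^sub>b\<close> and that, for every letter \<open>x\<close> with orbit of size \<open>m\<close> under \<open>a\<close>, the state \<open>h|\<^sub>x\<close>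
  conjugates \<open>a\<^sup>m|\<^sub>x\<close> to \<open>b\<^sup>m|\<^sub>y\<close> with \<open>y = x\<^sup>h\<close>. The new pair lies again in the two
  orbit-signalizers, so a conjugator traces out a set of vertices \<open>(c, d, \<pi>)\<close> in which
  each vertex has a successor at each orbit representative. Pruning keeps exactly the union of all
  such sets (\<open>conjugator_graph_greatest\<close>), since the graph is finite. Hence, if \<open>a\<close> and \<open>b\<close> are
  conjugate, then a vertex \<open>(a, b, \<pi>)\<close> survives (\<open>intertwiners_successor_closed\<close>).

  Conversely, choose in the surviving graph one successor \<open>u\<^sub>i\<close> of each vertex \<open>u = (c, d, \<pi>)\<close> at
  each orbit representative \<open>x\<^sub>i\<close>. Conjugation leaves no further freedom: if \<open>y\<close> is the image of
  \<open>x\<^sub>i\<close> under \<open>c\<^sup>k\<close>, then the state at \<open>y\<close> of a conjugator \<open>h\<^sub>u\<close> is forced to be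
  \<open>(c\<^sup>k|\<^sub>x)\<inverse> h\<^sub>v d\<^sup>k|\<^sub>z\<close>, where \<open>x = x\<^sub>i\<close>, \<open>v = u\<^sub>i\<close> and \<open>z = x\<^sup>\<pi>\<close>. These equations define all
  \<open>h\<^sub>u\<close> simultaneously, level by level, and each \<open>h\<^sub>u\<close> does conjugate \<open>c\<close> to \<open>d\<close>
  (\<open>conjugator_intertwines\<close>). They also are the functional recursion: states of powers of \<open>c\<close> are
  states of powers of \<open>a\<close>, hence products of states of \<open>a\<close>, and likewise for \<open>d\<close> and \<open>b\<close>.
  So the \<open>h\<^sub>u\<close>, the states of \<open>a\<close> and the states of \<open>b\<close> together form a functionally recursive
  set, finite because \<open>a\<close> and \<open>b\<close> are finite-state and the graph is finite
  (\<open>successor_closed_conjugate\<close>).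
\<close>


section \<open>States and root permutations\<close>

lemma carrier_Aut_T [simp]: "carrier Aut_T = tree_auts"
  by (simp add: Aut_T_def)

lemma mult_Aut_T [simp]: "g \<otimes>\<^bsub>Aut_T\<^esub> h = h \<circ> g"
  by (simp add: Aut_T_def)

lemma one_Aut_T [simp]: "\<one>\<^bsub>Aut_T\<^esub> = id"
  by (simp add: Aut_T_def)

interpretation Aut_T: group Aut_T
  by (rule group_Aut_T)

lemma bij_tree_auts: "g \<in> tree_auts \<Longrightarrow> bij g"
  by (simp add: tree_auts_def)

lemma inv_Aut_T: "g \<in> tree_auts \<Longrightarrow> inv\<^bsub>Aut_T\<^esub> g = inv_into UNIV g"
  by (rule Aut_T.inv_equality)
    (auto simp: tree_auts_inv surj_iff[symmetric] bij_tree_auts bij_is_surj)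

lemma state_tree_auts: "g \<in> tree_auts \<Longrightarrow> state g v \<in> tree_auts"
  using state_in_Aut_T[of g v] by simp

lemma tree_auts_funpow: "g \<in> tree_auts \<Longrightarrow> g ^^ n \<in> tree_auts"
proof (induction n)
  case 0
  then show ?case using Aut_T.one_closed by (simp add: id_def)
next
  case (Suc n)
  then show ?case using tree_auts_comp[of "g ^^ n" g] by (simp add: comp_def)
qed

lemma tree_auts_Nil [simp]: "g \<in> tree_auts \<Longrightarrow> g [] = []"
  by (simp add: tree_auts_def)

lemma tree_auts_take:
  assumes "g \<in> tree_auts"
  shows "g (take n w) = take n (g w)"
proof -
  have "g w = g (take n w) @ state g (take n w) (drop n w)"
    using tree_auts_append(1)[OF assms, of "take n w" "drop n w"] by simp
  then show ?thesis
    using tree_auts_append(2)[OF assms, of "take n w"] tree_auts_append(2)[OF assms, of w]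
    by (cases "n \<le> length w") (simp_all add: take_append)
qed

text \<open>
  Each level is finite, so an injection that preserves levels is onto; compatibility with prefixes
  carries edges to edges, and injectivity reflects them.
\<close>

lemma tree_autsI:
  assumes len: "\<And>w. length (g w) = length w"
    and take: "\<And>n w. g (take n w) = take n (g w)"
    and inj: "inj (g :: 'x::finite list \<Rightarrow> 'x list)"
  shows "g \<in> tree_auts"
proof -
  have "surj g"
  proof (rule surjI)
    fix w :: "'x list"
    let ?L = "{v :: 'x list. length v = length w}"
    have "finite ?L"
      using finite_lists_length_eq[of "UNIV :: 'x set" "length w"] by simp
    then have "g ` ?L = ?L"
      using inj len by (intro endo_inj_surj) (auto intro: inj_on_subset)
    then have "w \<in> range g" by auto
    then show "g (inv_into UNIV g w) = w" by (rule f_inv_into_f)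
  qed
  have adj: "(\<exists>y. g v = g u @ [y]) \<longleftrightarrow> (\<exists>x. v = u @ [x])" for u v
  proof -
    have snoc: "(\<exists>x. v = u @ [x]) \<longleftrightarrow> length v = Suc (length u) \<and> take (length u) v = u"
      for u v :: "'x list"
      by (cases v rule: rev_cases) auto
    have "g (take (length u) v) = g u \<longleftrightarrow> take (length u) v = u"
      using inj by (simp add: inj_eq)
    then show ?thesis by (simp add: snoc len take)
  qed
  have "tree_adj (g u) (g v) \<longleftrightarrow> tree_adj u v" for u v
    by (simp only: tree_adj_def ex_disj_distrib adj)
  moreover have "g [] = []" using len[of "[]"] by simp
  ultimately show ?thesis
    using inj \<open>surj g\<close> by (simp only: tree_auts_def bij_def mem_Collect_eq simp_thms)
qed

lemma state_Nil [simp]: "state g [] = g"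
  by (simp add: state_def)

lemma state_id [simp]: "state id v = id"
  by (auto simp: state_def)

lemma state_append: "state g (v @ w) = state (state g v) w"
  by (simp add: state_def add.commute)

lemma state_comp:
  assumes "g \<in> tree_auts" "h \<in> tree_auts"
  shows "state (h \<circ> g) v = state h (g v) \<circ> state g v"
  using tree_auts_append[OF assms(1)] tree_auts_append[OF assms(2)]
  by (auto simp: state_def fun_eq_iff)

lemma tree_auts_Cons:
  assumes "g \<in> tree_auts"
  shows "g (x # w) = root_perm g x # state g [x] w"
proof -
  have "length (g [x]) = 1" using tree_auts_append(2)[OF assms, of "[x]"] by simp
  then have "g [x] = [root_perm g x]" by (cases "g [x]") (auto simp: root_perm_def)
  then show ?thesis using tree_auts_append(1)[OF assms, of "[x]" w] by simp
qed

lemma tree_auts_singleton: "g \<in> tree_auts \<Longrightarrow> g [x] = [root_perm g x]"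
  by (simp add: tree_auts_Cons state_tree_auts)

lemma root_perm_comp:
  assumes "g \<in> tree_auts" "h \<in> tree_auts"
  shows "root_perm (h \<circ> g) = root_perm h \<circ> root_perm g"
  using tree_auts_singleton[OF assms(1)] tree_auts_singleton[OF assms(2)]
  by (simp add: root_perm_def fun_eq_iff)

lemma root_perm_funpow:
  assumes "g \<in> tree_auts"
  shows "root_perm (g ^^ n) = root_perm g ^^ n"
proof (induction n)
  case 0
  then show ?case by (simp add: root_perm_def fun_eq_iff)
next
  case (Suc n)
  then show ?case
    using root_perm_comp[OF tree_auts_funpow[OF assms] assms] by (simp only: funpow.simps)
qed

lemma bij_root_perm:
  assumes "g \<in> tree_auts"
  shows "bij (root_perm (g :: 'x::finite list \<Rightarrow> 'x list))"
proof -
  have "inj (root_perm g)"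
  proof (rule injI)
    fix x y assume "root_perm g x = root_perm g y"
    then have "g [x] = g [y]" using assms by (simp add: tree_auts_singleton)
    then show "x = y" using bij_tree_auts[OF assms] by (simp add: bij_def inj_eq)
  qed
  then show ?thesis by (simp add: bij_def finite_UNIV_inj_surj)
qed

lemma state_funpow_Suc:
  assumes "g \<in> tree_auts"
  shows "state (g ^^ Suc n) v = state g ((g ^^ n) v) \<circ> state (g ^^ n) v"
  using state_comp[OF tree_auts_funpow[OF assms] assms] by simp

text \<open>
  The commutation form avoids the inverse and is what composes with powers.
\<close>

lemma conj_perms_iff:
  "\<pi> \<in> conj_perms c d \<longleftrightarrow> bij \<pi> \<and> \<pi> \<circ> root_perm c = root_perm d \<circ> \<pi>"
proof (cases "bij \<pi>")
  case True
  then have inv: "\<pi> (inv_into UNIV \<pi> x) = x" "inv_into UNIV \<pi> (\<pi> x) = x" for x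
    by (simp_all add: bij_is_surj surj_f_inv_f bij_is_inj)
  have "(\<forall>x. \<pi> (root_perm c (inv_into UNIV \<pi> x)) = root_perm d x) \<longleftrightarrow>
      (\<forall>x. \<pi> (root_perm c x) = root_perm d (\<pi> x))"
    by (metis inv)
  then show ?thesis
    using True by (simp add: conj_perms_def fun_eq_iff)
qed (simp add: conj_perms_def)


section \<open>Orbits\<close>

text \<open>
  Orbit sizes are compared below through the set of exponents that fix a point, which turns each
  identity between them into an identity of divisors. An orbit starts with the image of the
  point, so the premise expresses that the point is periodic.
\<close>

lemma funpow_eq_self_iff:
  assumes "x \<in> orbit f x"
  shows "(f ^^ n) x = x \<longleftrightarrow> card (orbit f x) dvd n"
proof -
  define m where "m = funpow_dist1 f x x"
  have "0 < m" by (simp add: m_def)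
  have per: "(f ^^ m) x = x" using funpow_dist1_prop[OF assms] by (simp only: m_def)
  have least: "(f ^^ k) x \<noteq> x" if "0 < k" "k < m" for k
    using that unfolding m_def by (rule funpow_dist1_least)
  have "card (orbit f x) = card ((\<lambda>n. (f ^^ n) x) ` {0..<m})"
    using orbit_conv_funpow_dist1[OF assms] by (simp only: m_def)
  also have "\<dots> = m"
    using inj_on_funpow_dist1[OF assms] by (simp only: card_image m_def card_atLeastLessThan)
  finally have card: "card (orbit f x) = m" .
  have "(f ^^ (n mod m)) x = (f ^^ n) x"
    using per by (rule funpow_mod_eq)
  moreover have "(f ^^ (n mod m)) x = x \<longleftrightarrow> n mod m = 0"
    using least[of "n mod m"] \<open>0 < m\<close> by (cases "n mod m = 0") simp_all
  ultimately show ?thesis by (simp add: card dvd_eq_mod_eq_0)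
qed

lemma bij_self_in_orbit:
  fixes f :: "'a::finite \<Rightarrow> 'a"
  assumes "bij f"
  shows "x \<in> orbit f x"
proof -
  obtain n where "0 < n" "(f ^^ n) x = x"
    using funpow_inj_finite[of f x] assms by (auto simp: bij_def)
  then show ?thesis unfolding orbit_altdef by (intro CollectI exI[of _ n]) simp
qed

lemma tree_auts_length_funpow:
  assumes "g \<in> tree_auts"
  shows "length ((g ^^ n) v) = length v"
  using tree_auts_append(2)[OF tree_auts_funpow[OF assms]] .

lemma tree_auts_self_in_orbit:
  fixes g :: "'x::finite list \<Rightarrow> 'x list"
  assumes "g \<in> tree_auts"
  shows "v \<in> orbit g v"
proof -
  have "finite {w :: 'x list. length w = length v}"
    using finite_lists_length_eq[of "UNIV :: 'x set" "length v"] by simp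
  then have "finite {w. \<exists>n. w = (g ^^ n) v}"
    by (rule rev_finite_subset) (auto simp: tree_auts_length_funpow[OF assms])
  moreover have "inj g" using bij_tree_auts[OF assms] by (simp add: bij_def)
  ultimately obtain n where "0 < n" "(g ^^ n) v = v"
    using funpow_inj_finite[of g v] by blast
  then show ?thesis unfolding orbit_altdef by (intro CollectI exI[of _ n]) simp
qed

lemma funpow_append:
  assumes "g \<in> tree_auts" "g v = v"
  shows "(g ^^ n) (v @ w) = v @ (state g v ^^ n) w" and "state (g ^^ n) v = state g v ^^ n"
proof -
  show *: "(g ^^ n) (v @ w) = v @ (state g v ^^ n) w" for w
    by (induction n) (simp_all add: tree_auts_append(1)[OF assms(1)] assms(2))
  show "state (g ^^ n) v = state g v ^^ n"
    by (simp add: state_def * fun_eq_iff)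
qed

lemma card_orbit_eqI:
  assumes "x \<in> orbit f x" "y \<in> orbit g y"
    and "\<And>n. (f ^^ n) x = x \<longleftrightarrow> (g ^^ n) y = y"
  shows "card (orbit f x) = card (orbit g y)"
  using assms(3) by (metis funpow_eq_self_iff assms(1,2) dvd_antisym dvd_refl)

text \<open>
  An exponent fixing \<open>v @ w\<close> fixes \<open>v\<close>, hence is a multiple \<open>m t\<close> of the size \<open>m\<close> of the orbit of
  \<open>v\<close>, and then \<open>g\<^sup>m\<^sup>t\<close> acts on \<open>w\<close> below \<open>v\<close> as \<open>c\<^sup>t\<close>.
\<close>

lemma card_orbit_append:
  fixes g :: "'x::finite list \<Rightarrow> 'x list"
  assumes g: "g \<in> tree_auts" and c_def: "c = state (g ^^ card (orbit g v)) v"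
  shows "card (orbit g (v @ w)) = card (orbit g v) * card (orbit c w)"
proof -
  let ?m = "card (orbit g v)"
  have c: "c \<in> tree_auts" by (simp add: c_def g state_tree_auts tree_auts_funpow)
  have fix_v: "(g ^^ ?m) v = v"
    by (simp add: funpow_eq_self_iff[OF tree_auts_self_in_orbit[OF g]])
  have "card (orbit g (v @ w)) dvd n \<longleftrightarrow> ?m * card (orbit c w) dvd n" for n
  proof -
    have prefix: "(g ^^ n) v = v" if "(g ^^ n) (v @ w) = v @ w"
      using that tree_auts_append[OF tree_auts_funpow[OF g, of n], of v] by simp
    have iter: "(g ^^ (?m * t)) (v @ w) = v @ (c ^^ t) w" for t
      using funpow_append(1)[OF tree_auts_funpow[OF g] fix_v, of t w]
      by (simp add: c_def funpow_mult)
    have "card (orbit g (v @ w)) dvd n \<longleftrightarrow> (g ^^ n) (v @ w) = v @ w"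
      by (simp add: funpow_eq_self_iff[OF tree_auts_self_in_orbit[OF g]])
    also have "\<dots> \<longleftrightarrow> (\<exists>t. n = ?m * t \<and> (c ^^ t) w = w)"
    proof
      assume A: "(g ^^ n) (v @ w) = v @ w"
      then have "?m dvd n"
        using prefix funpow_eq_self_iff[OF tree_auts_self_in_orbit[OF g]] by blast
      then obtain t where "n = ?m * t" ..
      then show "\<exists>t. n = ?m * t \<and> (c ^^ t) w = w" using A iter by auto
    qed (auto simp: iter)
    also have "\<dots> \<longleftrightarrow> (\<exists>t. n = ?m * t \<and> card (orbit c w) dvd t)"
      by (simp add: funpow_eq_self_iff[OF tree_auts_self_in_orbit[OF c]])
    also have "\<dots> \<longleftrightarrow> ?m * card (orbit c w) dvd n"
      by (auto simp: dvd_def mult.assoc)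
    finally show ?thesis .
  qed
  then show ?thesis by (meson dvd_antisym dvd_refl)
qed

lemma root_perm_self_in_orbit:
  "c \<in> tree_auts \<Longrightarrow> x \<in> orbit (root_perm (c :: 'x::finite list \<Rightarrow> 'x list)) x"
  by (intro bij_self_in_orbit bij_root_perm)

lemma card_orbit_singleton:
  fixes g :: "'x::finite list \<Rightarrow> 'x list"
  assumes g: "g \<in> tree_auts"
  shows "card (orbit g [x]) = orbit_size g x"
  unfolding orbit_size_def
  by (rule card_orbit_eqI)
    (simp_all add: g root_perm_self_in_orbit tree_auts_self_in_orbit
      tree_auts_singleton[OF tree_auts_funpow[OF g]] root_perm_funpow[OF g])

lemma funpow_orbit_size:
  fixes c :: "'x::finite list \<Rightarrow> 'x list"
  assumes "c \<in> tree_auts"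
  shows "(c ^^ orbit_size c x) [x] = [x]"
  by (simp add: funpow_eq_self_iff[OF tree_auts_self_in_orbit[OF assms]]
      card_orbit_singleton[OF assms])

lemma intertwine_funpow:
  assumes "f \<circ> g = h \<circ> f"
  shows "f \<circ> g ^^ n = h ^^ n \<circ> f"
proof (induction n)
  case (Suc n)
  have "f ((g ^^ Suc n) x) = (h ^^ Suc n) (f x)" for x
    using assms Suc by (simp add: fun_eq_iff)
  then show ?case by (simp add: fun_eq_iff)
qed simp

text \<open>
  This is why \<open>succ_pair\<close> may use the orbit size of \<open>x\<close> under \<open>c\<close> for both components.
\<close>

lemma orbit_size_conj:
  fixes c d :: "'x::finite list \<Rightarrow> 'x list"
  assumes "c \<in> tree_auts" "d \<in> tree_auts" "\<pi> \<in> conj_perms c d"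
  shows "orbit_size d (\<pi> x) = orbit_size c x"
proof -
  have \<pi>: "inj \<pi>" "\<pi> \<circ> root_perm c = root_perm d \<circ> \<pi>"
    using assms(3) by (auto simp: conj_perms_iff bij_def)
  have "(root_perm d ^^ n) (\<pi> x) = \<pi> ((root_perm c ^^ n) x)" for n
    using intertwine_funpow[OF \<pi>(2), of n] by (simp add: fun_eq_iff)
  then show ?thesis
    unfolding orbit_size_def
    by (intro card_orbit_eqI) (simp_all add: assms root_perm_self_in_orbit inj_eq[OF \<pi>(1)])
qed

lemma orbit_signalizer_tree_auts: "a \<in> tree_auts \<Longrightarrow> c \<in> orbit_signalizer a \<Longrightarrow> c \<in> tree_auts"
  by (auto simp: orbit_signalizer_def state_tree_auts tree_auts_funpow)

lemma orbit_signalizer_self: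
  assumes "a \<in> tree_auts"
  shows "a \<in> orbit_signalizer a"
proof -
  have "orbit a [] = {[]}" using assms by (simp add: orbit_eq_singleton_iff)
  then have "state (a ^^ card (orbit a [])) [] = a" by simp
  then show ?thesis
    unfolding orbit_signalizer_def by (intro CollectI exI[of _ "[]"]) simp
qed

text \<open>
  Powers of an element of the orbit-signalizer are still single states of powers of \<open>a\<close>, because
  \<open>a\<^sup>m\<close> fixes \<open>v\<close> when \<open>m\<close> is the size of the orbit of \<open>v\<close>.
\<close>

lemma orbit_signalizerE:
  fixes a :: "'x::finite list \<Rightarrow> 'x list"
  assumes a: "a \<in> tree_auts" and c: "c \<in> orbit_signalizer a"
  obtains v where "c = state (a ^^ card (orbit a v)) v"
    and "\<And>k. c ^^ k = state (a ^^ (card (orbit a v) * k)) v"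
proof -
  obtain v where v: "c = state (a ^^ card (orbit a v)) v"
    using c by (auto simp: orbit_signalizer_def)
  have "(a ^^ card (orbit a v)) v = v"
    by (simp add: funpow_eq_self_iff[OF tree_auts_self_in_orbit[OF a]])
  then have "c ^^ k = state (a ^^ (card (orbit a v) * k)) v" for k
    using funpow_append(2)[OF tree_auts_funpow[OF a]] by (simp add: v funpow_mult)
  then show thesis using v that by blast
qed

text \<open>
  If \<open>c\<close> arises from the word \<open>v\<close>, its successor arises from \<open>v @ [x]\<close>: orbit sizes multiply
  along the word.
\<close>

lemma orbit_signalizer_step:
  fixes a :: "'x::finite list \<Rightarrow> 'x list"
  assumes a: "a \<in> tree_auts" and c: "c \<in> orbit_signalizer a"
  shows "state (c ^^ orbit_size c x) [x] \<in> orbit_signalizer a"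
proof -
  obtain v where v: "c = state (a ^^ card (orbit a v)) v"
    and pow: "\<And>k. c ^^ k = state (a ^^ (card (orbit a v) * k)) v"
    by (rule orbit_signalizerE[OF a c]) blast
  have "card (orbit a (v @ [x])) = card (orbit a v) * orbit_size c x"
    using card_orbit_append[OF a v, of "[x]"]
      card_orbit_singleton[OF orbit_signalizer_tree_auts[OF a c]] by simp
  then have
    "state (c ^^ orbit_size c x) [x] = state (a ^^ card (orbit a (v @ [x]))) (v @ [x])"
    by (simp add: pow state_append)
  then show ?thesis by (auto simp: orbit_signalizer_def)
qed


section \<open>The reduced graph as a greatest fixed point\<close>

text \<open>
  This is the property that pruning preserves: the sets of vertices that justify each other's
  presence.
\<close>

definition successor_closed ::
  "('x::{finite,linorder} list \<Rightarrow> 'x list) \<Rightarrow> ('x list \<Rightarrow> 'x list) \<Rightarrow> 'x vertex set \<Rightarrow> bool" where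
  "successor_closed a b P \<longleftrightarrow> P \<subseteq> verts (initial_graph a b) \<and>
     (\<forall>u\<in>P. \<forall>x\<in>orbit_reps (fst u). \<exists>\<tau>. (fst (succ_pair u x), snd (succ_pair u x), \<tau>) \<in> P)"

lemma finite_verts_initial_graph:
  assumes "finite (orbit_signalizer a)" "finite (orbit_signalizer b)"
  shows "finite (verts (initial_graph a b))"
  by (rule finite_subset[of _ "orbit_signalizer a \<times> orbit_signalizer b \<times> UNIV"])
    (use assms in \<open>auto simp: initial_graph_def\<close>)

lemma verts_initial_graph:
  "(c, d, \<pi>) \<in> verts (initial_graph a b) \<longleftrightarrow>
     c \<in> orbit_signalizer a \<and> d \<in> orbit_signalizer b \<and> \<pi> \<in> conj_perms c d"
  by (simp add: initial_graph_def)

lemma succ_pair_orbit_signalizer: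
  fixes a b :: "'x::{finite,linorder} list \<Rightarrow> 'x list"
  assumes "a \<in> tree_auts" "b \<in> tree_auts" "u \<in> verts (initial_graph a b)"
  shows "fst (succ_pair u x) \<in> orbit_signalizer a" "snd (succ_pair u x) \<in> orbit_signalizer b"
proof -
  obtain c d \<pi> where u: "u = (c, d, \<pi>)" by (cases u)
  have c: "c \<in> orbit_signalizer a" and d: "d \<in> orbit_signalizer b" and \<pi>: "\<pi> \<in> conj_perms c d"
    using assms(3) by (simp_all add: u verts_initial_graph)
  have "orbit_size d (\<pi> x) = orbit_size c x"
    using orbit_size_conj[OF _ _ \<pi>] orbit_signalizer_tree_auts assms(1,2) c d by blast
  then show "fst (succ_pair u x) \<in> orbit_signalizer a" "snd (succ_pair u x) \<in> orbit_signalizer b"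
    using orbit_signalizer_step[OF assms(1) c, of x] orbit_signalizer_step[OF assms(2) d, of "\<pi> x"]
    by (simp_all add: u)
qed

text \<open>
  Every pruning step keeps each successor-closed set and yields an induced subgraph of the initial
  graph. As the graph is finite, pruning stops, and a graph that it leaves unchanged has a
  successor-closed set of vertices.
\<close>

lemma conjugator_graph_greatest:
  fixes a b :: "'x::{finite,linorder} list \<Rightarrow> 'x list"
  assumes aut: "a \<in> tree_auts" "b \<in> tree_auts"
    and fin: "finite (orbit_signalizer a)" "finite (orbit_signalizer b)"
  shows "successor_closed a b (verts (conjugator_graph a b))" (is ?closed)
    and "\<And>P. successor_closed a b P \<Longrightarrow> P \<subseteq> verts (conjugator_graph a b)"
proof -
  let ?I = "initial_graph a b"
  define Inv where "Inv G \<longleftrightarrow> verts G \<subseteq> verts ?I \<and>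
    arcs G = {e \<in> arcs ?I. fst e \<in> verts G \<and> snd (snd e) \<in> verts G} \<and>
    tail G = fst \<and> head G = snd \<circ> snd \<and> (\<forall>P. successor_closed a b P \<longrightarrow> P \<subseteq> verts G)"
    for G :: "('x vertex, 'x vertex \<times> 'x \<times> 'x vertex) pre_digraph"
  let ?V = "\<lambda>G. {u \<in> verts G. \<forall>x\<in>orbit_reps (fst u). \<exists>e\<in>arcs G. tail G e = u \<and> fst (snd e) = x}"
  have ends: "tail ?I = fst" "head ?I = snd \<circ> snd"
    by (simp_all add: initial_graph_def)
  have arcs_I: "(u, x, c, d, \<tau>) \<in> arcs ?I \<longleftrightarrow> u \<in> verts ?I \<and> \<not> dead_vertex u \<and>
      x \<in> orbit_reps (fst u) \<and> (c, d) = succ_pair u x \<and> \<tau> \<in> conj_perms c d" for u x c d \<tau>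
    by (auto simp: initial_graph_def)
  have arcs_G: "e \<in> arcs G \<longleftrightarrow> e \<in> arcs ?I \<and> fst e \<in> verts G \<and> snd (snd e) \<in> verts G"
    and tail_G: "tail G = fst" if "Inv G" for G e
    using that by (auto simp: Inv_def)
  have verts_prune: "verts (prune G) = ?V G" for G
    by (simp add: prune_def)
  have step: "P \<subseteq> ?V G" if "Inv G" and P: "successor_closed a b P" for G P
  proof
    fix u assume u: "u \<in> P"
    have P_I: "P \<subseteq> verts ?I" and P_G: "P \<subseteq> verts G"
      and succ: "\<exists>\<tau>. (fst (succ_pair u x), snd (succ_pair u x), \<tau>) \<in> P"
      if "x \<in> orbit_reps (fst u)" for x
      using P \<open>Inv G\<close> u that by (auto simp: successor_closed_def Inv_def)
    have ne: "\<tau> \<in> conj_perms (fst (succ_pair u x)) (snd (succ_pair u x))"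
      if "x \<in> orbit_reps (fst u)" "(fst (succ_pair u x), snd (succ_pair u x), \<tau>) \<in> P" for x \<tau>
      using that P_I[OF that(1)] by (auto simp: verts_initial_graph)
    \<comment> \<open>The successors lie in the initial graph, which contains a pair only with a permutation.\<close>
    have live: "\<not> dead_vertex u"
      using succ ne by (fastforce simp: dead_vertex_def)
    have "\<exists>e\<in>arcs G. tail G e = u \<and> fst (snd e) = x" if x: "x \<in> orbit_reps (fst u)" for x
    proof -
      obtain \<tau> where \<tau>: "(fst (succ_pair u x), snd (succ_pair u x), \<tau>) \<in> P"
        using succ[OF x] by blast
      have "(u, x, fst (succ_pair u x), snd (succ_pair u x), \<tau>) \<in> arcs G"
        using \<tau> ne[OF x \<tau>] live x u P_I[OF x] P_G[OF x]
        by (auto simp: arcs_G[OF \<open>Inv G\<close>] arcs_I)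
      then show ?thesis by (force simp: tail_G[OF \<open>Inv G\<close>])
    qed
    moreover have "u \<in> verts G" using P u \<open>Inv G\<close> by (auto simp: Inv_def)
    ultimately show "u \<in> ?V G" by blast
  qed
  define C where "C = conjugator_graph a b"
  have "Inv C \<and> prune C = C"
    unfolding C_def conjugator_graph_def
  proof (rule while_rule[where P = Inv and r = "measure (card \<circ> verts)"])
    have "snd (snd e) \<in> verts ?I" if "e \<in> arcs ?I" for e
    proof -
      obtain u x c d \<tau> where e: "e = (u, x, c, d, \<tau>)" by (cases e)
      then have u: "u \<in> verts ?I" and cd: "(c, d) = succ_pair u x" and "\<tau> \<in> conj_perms c d"
        using that by (simp_all add: arcs_I)
      moreover have "c \<in> orbit_signalizer a" "d \<in> orbit_signalizer b"
        using succ_pair_orbit_signalizer[OF aut u, of x] by (simp_all flip: cd)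
      ultimately show ?thesis by (simp add: e verts_initial_graph)
    qed
    moreover have "fst e \<in> verts ?I" if "e \<in> arcs ?I" for e
      using that by (auto simp: initial_graph_def)
    ultimately show "Inv ?I"
      by (auto simp: Inv_def ends successor_closed_def)
  next
    fix G assume G: "Inv G"
    have "P \<subseteq> verts (prune G)" if "successor_closed a b P" for P
      using step[OF G that] by (simp only: verts_prune)
    then show "Inv (prune G)"
      using G by (auto simp: Inv_def prune_def)
    assume "prune G \<noteq> G"
    have "prune G = G" if "?V G = verts G"
    proof -
      have "prune G = induce_subgraph G (verts G)"
        by (simp only: prune_def that)
      moreover have "arcs (induce_subgraph G (verts G)) = arcs G"
        using arcs_G[OF G] tail_G[OF G] G by (auto simp: Inv_def)
      ultimately show ?thesis by (simp add: induce_subgraph_def)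
    qed
    then have "verts (prune G) \<subset> verts G"
      using \<open>prune G \<noteq> G\<close> unfolding verts_prune by blast
    moreover have "finite (verts G)"
      using G finite_verts_initial_graph[OF fin] by (auto simp: Inv_def intro: finite_subset)
    ultimately show "(prune G, G) \<in> measure (card \<circ> verts)"
      by (simp add: psubset_card_mono)
  qed auto
  then have C: "Inv C" and fixed: "prune C = C" by blast+
  have V: "verts C = ?V C"
    using verts_prune[of C] by (simp only: fixed)
  have "\<exists>\<tau>. (fst (succ_pair u x), snd (succ_pair u x), \<tau>) \<in> verts C"
    if u: "u \<in> verts C" and x: "x \<in> orbit_reps (fst u)" for u x
  proof -
    have "u \<in> ?V C" using u by (simp only: V[symmetric])
    then obtain e where e: "e \<in> arcs C" "tail C e = u" "fst (snd e) = x"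
      using x by blast
    moreover obtain c d \<tau> where "snd (snd e) = (c, d, \<tau>)" by (cases "snd (snd e)")
    ultimately have e_eq: "e = (u, x, c, d, \<tau>)"
      by (simp add: prod_eq_iff tail_G[OF C])
    then have "(u, x, c, d, \<tau>) \<in> arcs ?I" and \<tau>: "(c, d, \<tau>) \<in> verts C"
      using arcs_G[OF C, of e] e(1) by simp_all
    then have "succ_pair u x = (c, d)" by (simp add: arcs_I)
    then show ?thesis using \<tau> by auto
  qed
  then show ?closed
    using C by (simp add: successor_closed_def Inv_def flip: C_def)
  show "P \<subseteq> verts (conjugator_graph a b)" if "successor_closed a b P" for P
    using C that by (simp add: Inv_def flip: C_def)
qed


section \<open>From a conjugator to surviving vertices\<close>

lemma conjugate_in_Aut_T_iff:
  "conjugate_in Aut_T a b \<longleftrightarrow>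
     a \<in> tree_auts \<and> b \<in> tree_auts \<and> (\<exists>h\<in>tree_auts. h \<circ> a = b \<circ> h)"
proof -
  have "h \<circ> (a \<circ> inv_into UNIV h) = b \<longleftrightarrow> h \<circ> a = b \<circ> h" if "h \<in> tree_auts" for h
  proof -
    have "h \<circ> inv_into UNIV h = id" "inv_into UNIV h \<circ> h = id"
      using bij_tree_auts[OF that] by (auto simp: bij_def surj_iff)
    then show ?thesis by (metis comp_assoc comp_id)
  qed
  then show ?thesis by (simp add: conjugate_in_def inv_Aut_T cong: bex_cong)
qed

text \<open>
  At \<open>x\<close>, the successor of a vertex coming from \<open>h\<close> is the vertex coming from \<open>h|\<^sub>x\<close>: compare the
  states at \<open>x\<close> of both sides of \<open>c\<^sup>m h = h d\<^sup>m\<close>, where \<open>c\<^sup>m\<close> fixes \<open>x\<close>.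
\<close>

lemma intertwiners_successor_closed:
  fixes a b :: "'x::{finite,linorder} list \<Rightarrow> 'x list"
  assumes aut: "a \<in> tree_auts" "b \<in> tree_auts"
  shows "successor_closed a b {(c, d, root_perm h) | c d h. c \<in> orbit_signalizer a \<and>
           d \<in> orbit_signalizer b \<and> h \<in> tree_auts \<and> h \<circ> c = d \<circ> h}" (is "successor_closed a b ?P")
proof -
  have P_I: "?P \<subseteq> verts (initial_graph a b)"
  proof
    fix u assume "u \<in> ?P"
    then obtain c d h where u: "u = (c, d, root_perm h)" and c: "c \<in> orbit_signalizer a"
      and d: "d \<in> orbit_signalizer b" and h: "h \<in> tree_auts" and eq: "h \<circ> c = d \<circ> h" by blast
    have "root_perm h \<circ> root_perm c = root_perm d \<circ> root_perm h"
      using root_perm_comp[OF _ h, of c] root_perm_comp[OF h, of d] c d eq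
        orbit_signalizer_tree_auts aut by metis
    then show "u \<in> verts (initial_graph a b)"
      using c d bij_root_perm[OF h] by (simp add: u verts_initial_graph conj_perms_iff)
  qed
  moreover have "\<exists>\<tau>. (fst (succ_pair u x), snd (succ_pair u x), \<tau>) \<in> ?P" if "u \<in> ?P" for u x
  proof -
    obtain c d h where u: "u = (c, d, root_perm h)" and c: "c \<in> orbit_signalizer a"
      and d: "d \<in> orbit_signalizer b" and h: "h \<in> tree_auts" and eq: "h \<circ> c = d \<circ> h"
      using \<open>u \<in> ?P\<close> by blast
    let ?m = "orbit_size c x"
    have ct: "c \<in> tree_auts" and dt: "d \<in> tree_auts"
      using c d aut orbit_signalizer_tree_auts by blast+
    have "state h ((c ^^ ?m) [x]) \<circ> state (c ^^ ?m) [x] = state (d ^^ ?m) (h [x]) \<circ> state h [x]"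
      using intertwine_funpow[OF eq, of ?m] state_comp[OF tree_auts_funpow[OF ct] h]
        state_comp[OF h tree_auts_funpow[OF dt]] by metis
    then have "state h [x] \<circ> fst (succ_pair u x) = snd (succ_pair u x) \<circ> state h [x]"
      using funpow_orbit_size[OF ct] tree_auts_singleton[OF h] by (simp add: u)
    moreover have "u \<in> verts (initial_graph a b)" using P_I \<open>u \<in> ?P\<close> by (rule subsetD)
    ultimately have "(fst (succ_pair u x), snd (succ_pair u x), root_perm (state h [x])) \<in> ?P"
      using succ_pair_orbit_signalizer[OF aut, of u x] state_tree_auts[OF h, of "[x]"]
      unfolding mem_Collect_eq
      by (intro exI[of _ "fst (succ_pair u x)"] exI[of _ "snd (succ_pair u x)"]
          exI[of _ "state h [x]"]) simp
    then show ?thesis by (intro exI[of _ "root_perm (state h [x])"])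
  qed
  ultimately show ?thesis
    unfolding successor_closed_def by (intro conjI ballI)
qed


section \<open>Functionally recursive automorphisms\<close>

lemma (in group) word_value_lists_generate:
  assumes "S \<subseteq> carrier G"
  shows "word_value G ` lists (S \<union> m_inv G ` S) = generate G S"
proof (intro equalityI subsetI)
  fix g assume "g \<in> word_value G ` lists (S \<union> m_inv G ` S)"
  then obtain w where w: "w \<in> lists (S \<union> m_inv G ` S)" and g: "g = word_value G w" by blast
  from w have "word_value G w \<in> generate G S"
  proof (induction w)
    case Nil
    then show ?case by (simp add: word_value_def generate.one)
  next
    case (Cons s w)
    then have "s \<in> generate G S" by (auto intro: generate.incl generate.inv)
    then show ?case using Cons by (auto simp: word_value_def intro: generate.eng)
  qed
  then show "g \<in> generate G S" by (simp add: g)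
next
  let ?L = "lists (S \<union> m_inv G ` S)"
  have closed: "word_value G w \<in> carrier G" if "w \<in> ?L" for w
    using that by induction (use assms in \<open>auto simp: word_value_def\<close>)
  have append: "word_value G (v @ w) = word_value G v \<otimes> word_value G w" if "v \<in> ?L" "w \<in> ?L" for v w
    using that(1)
  proof induction
    case Nil
    then show ?case using closed[OF that(2)] by (simp add: word_value_def)
  next
    case (Cons s v)
    have "s \<in> carrier G" using Cons assms by auto
    then show ?case
      using Cons closed[OF Cons(2)] closed[OF that(2)] by (simp add: word_value_def m_assoc)
  qed
  fix g assume "g \<in> generate G S"
  then show "g \<in> word_value G ` ?L"
  proof induction
    case one
    show ?case by (rule image_eqI[of _ _ "[]"]) (simp_all add: word_value_def)
  next
    case (incl h)
    then show ?case
      by (intro image_eqI[of _ _ "[h]"]) (use assms in \<open>auto simp: word_value_def\<close>)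
  next
    case (inv h)
    then show ?case
      by (intro image_eqI[of _ _ "[inv h]"]) (use assms in \<open>auto simp: word_value_def\<close>)
  next
    case (eng g h)
    then obtain v w where vw: "v \<in> ?L" "g = word_value G v" "w \<in> ?L" "h = word_value G w" by blast
    then have "v @ w \<in> ?L" by (simp only: append_in_lists_conv simp_thms)
    then show ?case using append[OF vw(1,3)] vw(2,4) by (intro image_eqI[of _ _ "v @ w"]) simp_all
  qed
qed

text \<open>
  The existence of words and permutations is a closure condition on first-level states: the words
  over a set and its inverses represent exactly the elements of the subgroup that it generates, and
  the root permutation of an automorphism is the only possible choice of permutation.
\<close>

lemma functionally_recursive_set_iff:
  fixes S :: "('x::finite list \<Rightarrow> 'x list) set"
  shows "functionally_recursive_set S \<longleftrightarrow>
    finite S \<and> S \<subseteq> tree_auts \<and> (\<forall>g\<in>S. \<forall>x. state g [x] \<in> generate Aut_T S)"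
proof (cases "S \<subseteq> tree_auts")
  case True
  let ?L = "lists (S \<union> m_inv Aut_T ` S)"
  have words: "word_value Aut_T ` ?L = generate Aut_T S"
    using True by (intro Aut_T.word_value_lists_generate) simp
  have "(\<exists>w \<pi>. (\<forall>x. w x \<in> ?L) \<and> bij \<pi> \<and> g = wreath (\<lambda>x. word_value Aut_T (w x)) \<pi>) \<longleftrightarrow>
      (\<forall>x. state g [x] \<in> generate Aut_T S)" (is "?lhs \<longleftrightarrow> ?rhs") if g: "g \<in> tree_auts" for g
  proof
    assume ?lhs
    then obtain w \<pi> where w: "\<forall>x. w x \<in> ?L" and "g = wreath (\<lambda>x. word_value Aut_T (w x)) \<pi>" by blast
    then have "state g [x] = word_value Aut_T (w x)" for x
      by (simp add: state_def)
    then show ?rhs using w words by blast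
  next
    assume ?rhs
    then have "\<forall>x. \<exists>v. v \<in> ?L \<and> state g [x] = word_value Aut_T v"
      unfolding words[symmetric] by blast
    then obtain w where w: "\<forall>x. w x \<in> ?L \<and> state g [x] = word_value Aut_T (w x)" by metis
    have "g v = wreath (\<lambda>x. word_value Aut_T (w x)) (root_perm g) v" for v
      using w by (cases v) (simp_all add: g tree_auts_Cons[OF g])
    then have "g = wreath (\<lambda>x. word_value Aut_T (w x)) (root_perm g)" ..
    then show ?lhs using w bij_root_perm[OF g] by blast
  qed
  then show ?thesis
    using True unfolding functionally_recursive_set_def by (auto simp: subset_iff)
qed (simp add: functionally_recursive_set_def)

lemma carrier_RAut_T: "g \<in> carrier RAut_T \<longleftrightarrow> (\<exists>S. functionally_recursive_set S \<and> g \<in> S)"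
  by (simp add: RAut_T_def)

lemma RAut_T_subset: "carrier (RAut_T :: ('x::finite list \<Rightarrow> 'x list) monoid) \<subseteq> tree_auts"
  by (auto simp: carrier_RAut_T functionally_recursive_set_iff)

lemma state_inv:
  assumes g: "g \<in> tree_auts"
  shows "state (inv_into UNIV g) v = inv_into UNIV (state g (inv_into UNIV g v))"
proof -
  let ?h = "inv_into UNIV g" and ?s = "state g (inv_into UNIV g v)"
  have gh: "g (?h u) = u" for u
    using bij_tree_auts[OF g] by (simp add: bij_is_surj surj_f_inv_f)
  then have "g \<circ> ?h = id" by (simp add: fun_eq_iff)
  then have "?s \<circ> state ?h v = id"
    using state_comp[OF tree_auts_inv[OF g] g, of v] by simp
  moreover have "inj ?s" using bij_tree_auts[OF state_tree_auts[OF g]] by (simp add: bij_def)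
  ultimately show ?thesis
    by (metis inv_o_cancel comp_assoc comp_id id_comp)
qed

text \<open>
  Adding the inverses of its elements to a functionally recursive set keeps it functionally
  recursive, since the states of an inverse are inverses of states. This makes the inverse taken in
  \<open>RAut_T\<close> meaningful: it is the inverse in \<open>Aut_T\<close> (\<open>inv_RAut_T\<close>).
\<close>

lemma RAut_T_inv_closed:
  assumes "(g :: 'x::finite list \<Rightarrow> 'x list) \<in> carrier RAut_T"
  shows "inv_into UNIV g \<in> carrier RAut_T"
proof -
  obtain S where S: "finite S" "S \<subseteq> tree_auts" and rec: "\<And>g x. g \<in> S \<Longrightarrow> state g [x] \<in> generate Aut_T S"
    and g: "g \<in> S"
    using assms by (auto simp: carrier_RAut_T functionally_recursive_set_iff)
  let ?S = "S \<union> m_inv Aut_T ` S"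
  have mono: "generate Aut_T S \<subseteq> generate Aut_T ?S"
    by (rule Aut_T.mono_generate) blast
  have "state h [x] \<in> generate Aut_T ?S" if h: "h \<in> ?S" for h x
  proof (cases "h \<in> S")
    case True
    then show ?thesis using rec mono by blast
  next
    case False
    then obtain k where "k \<in> S" "h = m_inv Aut_T k" using h by blast
    then have k: "k \<in> S" "h = inv_into UNIV k" and kt: "k \<in> tree_auts"
      using S(2) by (auto simp: inv_Aut_T subset_iff)
    have "h [x] = [root_perm h x]"
      using kt by (simp add: k tree_auts_singleton tree_auts_inv)
    then have "state h [x] = m_inv Aut_T (state k [root_perm h x])"
      using state_inv[OF kt, of "[x]"] by (simp add: k(2) inv_Aut_T state_tree_auts[OF kt])
    then show ?thesis
      using Aut_T.generate_m_inv_closed[of S] rec[OF k(1)] S(2) mono by (auto 0 3)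
  qed
  moreover have "?S \<subseteq> tree_auts" using S by (auto simp: inv_Aut_T tree_auts_inv)
  ultimately have "functionally_recursive_set ?S"
    using S(1) by (simp add: functionally_recursive_set_iff)
  moreover have "inv_into UNIV g \<in> ?S" using g S(2) by (force simp: inv_Aut_T)
  ultimately show ?thesis unfolding carrier_RAut_T by blast
qed

lemma inv_RAut_T:
  assumes "(g :: 'x::finite list \<Rightarrow> 'x list) \<in> carrier RAut_T"
  shows "inv\<^bsub>RAut_T\<^esub> g = inv_into UNIV g"
proof -
  have "bij g" using assms RAut_T_subset bij_tree_auts by blast
  then have "h \<circ> g = id \<and> g \<circ> h = id \<longleftrightarrow> h = inv_into UNIV g" for h
    by (metis bij_is_inj bij_is_surj inv_o_cancel inv_unique_comp surj_iff)
  then show ?thesis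
    using RAut_T_inv_closed[OF assms]
    by (auto simp: m_inv_def RAut_T_def intro!: the_equality)
qed

lemma conjugate_in_RAut_T_iff:
  fixes a b :: "'x::finite list \<Rightarrow> 'x list"
  shows "conjugate_in RAut_T a b \<longleftrightarrow>
     a \<in> carrier RAut_T \<and> b \<in> carrier RAut_T \<and> (\<exists>h\<in>carrier RAut_T. h \<circ> a = b \<circ> h)"
proof -
  have "inv\<^bsub>RAut_T\<^esub> h \<otimes>\<^bsub>RAut_T\<^esub> a \<otimes>\<^bsub>RAut_T\<^esub> h = b \<longleftrightarrow> h \<circ> a = b \<circ> h" if h: "h \<in> carrier RAut_T" for h
  proof -
    have "bij h" using h RAut_T_subset bij_tree_auts by blast
    then have "h \<circ> inv_into UNIV h = id" "inv_into UNIV h \<circ> h = id"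
      by (auto simp: bij_def surj_iff)
    moreover have "inv\<^bsub>RAut_T\<^esub> h \<otimes>\<^bsub>RAut_T\<^esub> a \<otimes>\<^bsub>RAut_T\<^esub> h = h \<circ> (a \<circ> inv_into UNIV h)"
      by (simp add: inv_RAut_T[OF h]) (simp add: RAut_T_def)
    ultimately show ?thesis by (metis comp_assoc comp_id)
  qed
  then show ?thesis by (simp add: conjugate_in_def cong: bex_cong)
qed

lemma finite_state_in_RAut_T:
  fixes a :: "'x::finite list \<Rightarrow> 'x list"
  assumes "a \<in> tree_auts" "finite_state a"
  shows "a \<in> carrier RAut_T"
proof -
  have "state (state a v) [x] \<in> generate Aut_T (range (state a))" for v x
    by (intro generate.incl) (simp flip: state_append)
  then have "functionally_recursive_set (range (state a))"
    using assms state_tree_auts by (auto simp: functionally_recursive_set_iff finite_state_def)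
  moreover have "a \<in> range (state a)" by (rule range_eqI[of _ _ "[]"]) simp
  ultimately show ?thesis unfolding carrier_RAut_T by blast
qed

text \<open>
  A state of \<open>a\<^sup>n\<close> at \<open>v\<close> is the product of the states of \<open>a\<close> along the first \<open>n\<close> points of the
  trajectory of \<open>v\<close>.
\<close>

lemma state_funpow_in_generate:
  assumes "a \<in> tree_auts"
  shows "state (a ^^ n) v \<in> generate Aut_T (range (state a))"
proof (induction n)
  case 0
  show ?case using generate.one[of Aut_T] by (simp flip: id_def)
next
  case (Suc n)
  have "state a ((a ^^ n) v) \<in> generate Aut_T (range (state a))"
    by (intro generate.incl) simp
  with Suc have "state (a ^^ n) v \<otimes>\<^bsub>Aut_T\<^esub> state a ((a ^^ n) v) \<in> generate Aut_T (range (state a))"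
    by (rule generate.eng)
  then show ?case by (simp only: state_funpow_Suc[OF assms] mult_Aut_T)
qed

lemma orbit_signalizer_state_in_generate:
  fixes a :: "'x::finite list \<Rightarrow> 'x list"
  assumes "a \<in> tree_auts" "c \<in> orbit_signalizer a"
  shows "state (c ^^ k) w \<in> generate Aut_T (range (state a))"
proof -
  obtain v where "\<And>k. c ^^ k = state (a ^^ (card (orbit a v) * k)) v"
    by (rule orbit_signalizerE[OF assms]) blast
  then show ?thesis
    using state_funpow_in_generate[OF assms(1)] by (simp flip: state_append)
qed


section \<open>Conjugators from successor-closed sets\<close>

definition orbit_rep :: "('x::{finite,linorder} list \<Rightarrow> 'x list) \<Rightarrow> 'x \<Rightarrow> 'x" where
  "orbit_rep c y = Min (orbit (root_perm c) y)"

definition orbit_pos :: "('x::{finite,linorder} list \<Rightarrow> 'x list) \<Rightarrow> 'x \<Rightarrow> nat" where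
  "orbit_pos c y = funpow_dist (root_perm c) (orbit_rep c y) y"

lemma orbit_rep_in_orbit_reps: "orbit_rep c y \<in> orbit_reps c"
  by (simp add: orbit_rep_def orbit_reps_def)

text \<open>
  Counting positions within an orbit from its representative, one step of the permutation raises
  the position by one, except that the last point of the orbit returns to position 0.
\<close>

lemma
  fixes c :: "'x::{finite,linorder} list \<Rightarrow> 'x list"
  assumes c: "c \<in> tree_auts"
  shows funpow_orbit_pos: "(root_perm c ^^ orbit_pos c y) (orbit_rep c y) = y"
    and orbit_rep_step: "orbit_rep c (root_perm c y) = orbit_rep c y"
    and orbit_pos_step: "orbit_pos c (root_perm c y) = Suc (orbit_pos c y) \<or>
      orbit_pos c (root_perm c y) = 0 \<and> Suc (orbit_pos c y) = orbit_size c (orbit_rep c y)"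
proof -
  let ?f = "root_perm c" and ?r = "orbit_rep c y"
  note self = root_perm_self_in_orbit[OF c]
  have "?r \<in> orbit ?f y"
    unfolding orbit_rep_def by (rule Min_in) (simp_all add: orbit_nonempty)
  then have y: "y \<in> orbit ?f ?r" by (rule orbit_swap[OF self])
  then show reach: "(?f ^^ orbit_pos c y) ?r = y"
    unfolding orbit_pos_def by (rule funpow_dist_prop)
  show rep: "orbit_rep c (?f y) = ?r"
    by (simp add: orbit_rep_def self_in_orbit_step[OF self])
  have least: "orbit_pos c z \<le> n" if "(?f ^^ n) ?r = z" "orbit_rep c z = ?r" for n z
    using that funpow_dist_least[of n ?f ?r z] by (force simp: orbit_pos_def not_less[symmetric])
  have "(?f ^^ Suc (orbit_pos c y)) ?r = ?f y" using reach by simp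
  then have le: "orbit_pos c (?f y) \<le> Suc (orbit_pos c y)" using rep by (rule least)
  have reach': "(?f ^^ orbit_pos c (?f y)) ?r = ?f y"
    using orbit.step[OF y] rep funpow_dist_prop by (simp add: orbit_pos_def)
  show "orbit_pos c (?f y) = Suc (orbit_pos c y) \<or>
      orbit_pos c (?f y) = 0 \<and> Suc (orbit_pos c y) = orbit_size c ?r"
  proof (cases "orbit_pos c (?f y)")
    case 0
    then have "?f y = ?r" using reach' by simp
    then have "(?f ^^ Suc (orbit_pos c y)) ?r = ?r" using reach by simp
    then have dvd: "orbit_size c ?r dvd Suc (orbit_pos c y)"
      unfolding orbit_size_def by (simp only: funpow_eq_self_iff[OF self])
    have "(?f ^^ orbit_size c ?r) ?r = ?r"
      by (simp add: orbit_size_def funpow_eq_self_iff[OF self])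
    then have "(?f ^^ (orbit_pos c y mod orbit_size c ?r)) ?r = y"
      using reach by (simp add: funpow_mod_eq)
    then have "orbit_pos c y \<le> orbit_pos c y mod orbit_size c ?r" by (rule least) simp
    moreover have "orbit_size c ?r > 0" using dvd by (auto intro: gr0I)
    ultimately have "orbit_pos c y < orbit_size c ?r"
      using mod_less_divisor[of "orbit_size c ?r" "orbit_pos c y"] by linarith
    then have "Suc (orbit_pos c y) = orbit_size c ?r"
      using dvd_imp_le[OF dvd] by simp
    then show ?thesis using 0 by blast
  next
    case (Suc j)
    then have "?f ((?f ^^ j) ?r) = ?f y" using reach' by simp
    then have "(?f ^^ j) ?r = y" using bij_root_perm[OF c] by (simp add: bij_def inj_eq)
    then have "orbit_pos c y \<le> j" by (rule least) simp
    then show ?thesis using le Suc by simp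
  qed
qed

text \<open>
  A set of vertices together with one chosen successor in it for each vertex and each orbit
  representative.
\<close>

locale successor_choice =
  fixes P :: "'x::{finite,linorder} vertex set" and nxt :: "'x vertex \<Rightarrow> 'x \<Rightarrow> 'x vertex"
  assumes vertexD: "(c, d, \<pi>) \<in> P \<Longrightarrow> c \<in> tree_auts \<and> d \<in> tree_auts \<and> \<pi> \<in> conj_perms c d"
    and nxt_in: "u \<in> P \<Longrightarrow> x \<in> orbit_reps (fst u) \<Longrightarrow> nxt u x \<in> P"
    and nxt_succ: "u \<in> P \<Longrightarrow> x \<in> orbit_reps (fst u) \<Longrightarrow>
      (fst (nxt u x), fst (snd (nxt u x))) = succ_pair u x"
begin

text \<open>
  For \<open>y\<close> at position \<open>k\<close> in the orbit of \<open>x\<close>, the two factors are \<open>c\<^sup>k|\<^sub>x\<close> and \<open>d\<^sup>k|\<^sub>z\<close> with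
  \<open>z = x\<^sup>\<pi>\<close>. They transport a conjugator at \<open>x\<close> to one at \<open>y\<close>.
\<close>

definition left_factor :: "'x vertex \<Rightarrow> 'x \<Rightarrow> 'x list \<Rightarrow> 'x list" where
  "left_factor u y = state (fst u ^^ orbit_pos (fst u) y) [orbit_rep (fst u) y]"

definition right_factor :: "'x vertex \<Rightarrow> 'x \<Rightarrow> 'x list \<Rightarrow> 'x list" where
  "right_factor u y =
     state (fst (snd u) ^^ orbit_pos (fst u) y) [snd (snd u) (orbit_rep (fst u) y)]"

text \<open>
  The recursive call is applied to the tail of the word moved by the inverse of the left factor,
  which is not a subterm but has the same length as the tail. The recursion therefore runs over the
  level.
\<close>

primrec level_conjugator :: "nat \<Rightarrow> 'x vertex \<Rightarrow> 'x list \<Rightarrow> 'x list" where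
  "level_conjugator 0 u = id"
| "level_conjugator (Suc n) u = wreath
     (\<lambda>y. right_factor u y \<circ> level_conjugator n (nxt u (orbit_rep (fst u) y)) \<circ> inv_into UNIV (left_factor u y))
     (snd (snd u))"

definition conjugator :: "'x vertex \<Rightarrow> 'x list \<Rightarrow> 'x list" where
  "conjugator u w = level_conjugator (length w) u w"

lemma vertex_auts:
  assumes "u \<in> P"
  shows "fst u \<in> tree_auts" "fst (snd u) \<in> tree_auts" "snd (snd u) \<in> conj_perms (fst u) (fst (snd u))"
    and "bij (snd (snd u))"
  using vertexD[of "fst u" "fst (snd u)" "snd (snd u)"] assms by (auto simp: conj_perms_iff)

lemma factor_auts:
  assumes "u \<in> P"
  shows "left_factor u y \<in> tree_auts" "right_factor u y \<in> tree_auts"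
  using vertex_auts[OF assms] by (simp_all add: left_factor_def right_factor_def state_tree_auts tree_auts_funpow)

abbreviation follow :: "'x vertex \<Rightarrow> 'x \<Rightarrow> 'x vertex" where
  "follow u y \<equiv> nxt u (orbit_rep (fst u) y)"

lemma follow_in: "u \<in> P \<Longrightarrow> follow u y \<in> P"
  by (simp add: nxt_in orbit_rep_in_orbit_reps)

lemma conjugator_Nil [simp]: "conjugator u [] = []"
  by (simp add: conjugator_def)

lemma conjugator_Cons:
  assumes "u \<in> P"
  shows "conjugator u (y # w) =
    snd (snd u) y # right_factor u y (conjugator (follow u y) (inv_into UNIV (left_factor u y) w))"
  using tree_auts_append(2)[OF tree_auts_inv[OF factor_auts(1)[OF assms]]]
  by (simp add: conjugator_def)

lemma length_conjugator: "u \<in> P \<Longrightarrow> length (conjugator u w) = length w"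
proof (induction "length w" arbitrary: u w)
  case (Suc n)
  then obtain y w' where w: "w = y # w'" "length w' = n" by (cases w) auto
  let ?v = "inv_into UNIV (left_factor u y) w'"
  have v: "length ?v = n"
    using tree_auts_append(2)[OF tree_auts_inv[OF factor_auts(1)[OF Suc.prems]]] w by simp
  have "length (conjugator (follow u y) ?v) = n"
    using Suc.hyps(1)[OF v[symmetric] follow_in[OF Suc.prems]] v by simp
  then show ?case
    using tree_auts_append(2)[OF factor_auts(2)[OF Suc.prems]]
    by (simp add: w conjugator_Cons[OF Suc.prems])
qed simp

lemma conjugator_take: "u \<in> P \<Longrightarrow> conjugator u (take n w) = take n (conjugator u w)"
proof (induction n arbitrary: u w)
  case (Suc n)
  show ?case
  proof (cases w)
    case (Cons y w')
    have "conjugator u (take (Suc n) w) = snd (snd u) y #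
        right_factor u y (conjugator (follow u y) (take n (inv_into UNIV (left_factor u y) w')))"
      by (simp add: Cons conjugator_Cons[OF Suc.prems]
          tree_auts_take[OF tree_auts_inv[OF factor_auts(1)[OF Suc.prems]]])
    then show ?thesis
      by (simp add: Cons conjugator_Cons[OF Suc.prems] Suc.IH[OF follow_in[OF Suc.prems]]
          tree_auts_take[OF factor_auts(2)[OF Suc.prems]])
  qed simp
qed simp

lemma conjugator_inj: "u \<in> P \<Longrightarrow> conjugator u v = conjugator u w \<Longrightarrow> v = w"
proof (induction "length v" arbitrary: u v w)
  case 0
  then show ?case using length_conjugator[of u] by (metis length_0_conv)
next
  case (Suc n)
  have "length w = Suc n" using Suc length_conjugator[of u] by metis
  then obtain y w' where w: "w = y # w'" by (cases w) auto
  obtain x v' where v: "v = x # v'" "length v' = n" using Suc.hyps(2) by (cases v) auto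
  let ?l = "inv_into UNIV (left_factor u y)"
  have l: "?l \<in> tree_auts" using factor_auts(1)[OF Suc.prems(1)] by (rule tree_auts_inv)
  have inj: "inj (snd (snd u))" "inj (right_factor u y)" "inj ?l"
    using vertex_auts(4)[OF Suc.prems(1)] bij_tree_auts[OF l]
      bij_tree_auts[OF factor_auts(2)[OF Suc.prems(1)]] by (auto simp: bij_def)
  have xy: "x = y"
    using Suc.prems inj(1) by (simp add: v w conjugator_Cons inj_eq)
  then have "conjugator (follow u y) (?l v') = conjugator (follow u y) (?l w')"
    using Suc.prems inj(2) by (simp add: v w conjugator_Cons inj_eq)
  then have "?l v' = ?l w'"
    using Suc.hyps(1)[OF _ follow_in[OF Suc.prems(1)]] tree_auts_append(2)[OF l] v(2) by metis
  then show ?case using inj(3) by (simp add: v w xy inj_eq)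
qed

lemma conjugator_tree_auts: "u \<in> P \<Longrightarrow> conjugator u \<in> tree_auts"
  by (rule tree_autsI) (auto simp: length_conjugator conjugator_take intro: injI conjugator_inj)

text \<open>
  By induction on the level, simultaneously for all vertices. At a letter \<open>y\<close> that is not the
  last of its orbit, \<open>y\<close> and its image have the same chosen successor and factors that differ by
  \<open>c|\<^sub>y\<close> and the state of \<open>d\<close> at \<open>y\<^sup>\<pi>\<close>, so that the equation holds by cancellation. At the last letter the
  position wraps around, the factors at its image are trivial, and the equation becomes the one for
  the successor pair \<open>(c\<^sup>m|\<^sub>x, d\<^sup>m|\<^sub>z)\<close>, one level lower.
\<close>

lemma conjugator_intertwines:
  "u \<in> P \<Longrightarrow> conjugator u (fst u w) = fst (snd u) (conjugator u w)"
proof (induction "length w" arbitrary: u w)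
  case 0
  then show ?case using vertex_auts[OF 0(2)] by simp
next
  case (Suc n)
  note uP = Suc.prems
  obtain c d \<pi> where u: "u = (c, d, \<pi>)" by (cases u)
  have c: "c \<in> tree_auts" and d: "d \<in> tree_auts" and \<pi>: "\<pi> \<in> conj_perms c d"
    using vertexD uP by (simp_all add: u)
  have comm: "\<pi> (root_perm c z) = root_perm d (\<pi> z)" for z
    using \<pi> by (simp add: conj_perms_iff fun_eq_iff)
  have comm_pow: "\<pi> ((root_perm c ^^ k) z) = (root_perm d ^^ k) (\<pi> z)" for k z
    using intertwine_funpow[of \<pi> "root_perm c" "root_perm d" k] comm by (simp add: fun_eq_iff)
  obtain y w' where w: "w = y # w'" and w': "length w' = n"
    using Suc.hyps(2) by (cases w) auto
  define r k m where "r = orbit_rep c y" and "k = orbit_pos c y" and "m = orbit_size c r"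
  define u' where "u' = nxt u r"
  have follow: "follow u y = u'" "follow u (root_perm c y) = u'"
    by (simp_all add: u u'_def r_def orbit_rep_step[OF c])
  have u'P: "u' \<in> P" using follow_in[OF uP] follow(1) by metis
  have "(fst u', fst (snd u')) = succ_pair u r"
    unfolding u'_def using uP by (rule nxt_succ) (simp add: u r_def orbit_rep_in_orbit_reps)
  then have u': "fst u' = state (c ^^ m) [r]" "fst (snd u') = state (d ^^ m) [\<pi> r]"
    by (simp_all add: u m_def)
  have lr: "left_factor u y = state (c ^^ k) [r]" "right_factor u y = state (d ^^ k) [\<pi> r]"
    by (simp_all add: left_factor_def right_factor_def u k_def r_def)
  have pos: "(c ^^ k) [r] = [y]" "(d ^^ k) [\<pi> r] = [\<pi> y]"
    using funpow_orbit_pos[OF c, of y] comm_pow[of k r]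
    by (simp_all add: tree_auts_singleton tree_auts_funpow root_perm_funpow c d k_def r_def)
  have step_c: "state c [y] \<circ> left_factor u y = state (c ^^ Suc k) [r]"
    and step_d: "state d [\<pi> y] \<circ> right_factor u y = state (d ^^ Suc k) [\<pi> r]"
    using state_funpow_Suc[OF c, of k "[r]"] state_funpow_Suc[OF d, of k "[\<pi> r]"] lr pos
    by simp_all
  define z where "z = inv_into UNIV (left_factor u y) w'"
  have left: "left_factor u y \<in> tree_auts" using factor_auts[OF uP] by blast
  have "left_factor u y z = w'"
    using bij_tree_auts[OF left] by (simp add: z_def bij_is_surj surj_f_inv_f)
  then have cz: "state c [y] w' = state (c ^^ Suc k) [r] z"
    using step_c by (metis comp_apply)
  have len_z: "length z = n"
    using tree_auts_append(2)[OF tree_auts_inv[OF left]] w' by (simp add: z_def)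
  have rhs: "fst (snd u) (conjugator u w) =
      root_perm d (\<pi> y) # state (d ^^ Suc k) [\<pi> r] (conjugator u' z)"
    using fun_cong[OF step_d, of "conjugator u' z"] conjugator_Cons[OF uP, of y w'] follow(1)
    by (simp add: w u tree_auts_Cons[OF d] z_def del: funpow.simps)
  have lhs: "conjugator u (fst u w) = \<pi> (root_perm c y) #
      right_factor u (root_perm c y) (conjugator u' (inv_into UNIV (left_factor u (root_perm c y))
        (state (c ^^ Suc k) [r] z)))"
    using conjugator_Cons[OF uP, of "root_perm c y"] follow(2) cz
    by (simp add: w u tree_auts_Cons[OF c])
  have "right_factor u (root_perm c y) (conjugator u' (inv_into UNIV (left_factor u (root_perm c y))
        (state (c ^^ Suc k) [r] z))) = state (d ^^ Suc k) [\<pi> r] (conjugator u' z)"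
    using orbit_pos_step[OF c, of y]
  proof
    assume "orbit_pos c (root_perm c y) = Suc (orbit_pos c y)"
    then have lr': "left_factor u (root_perm c y) = state (c ^^ Suc k) [r]"
      "right_factor u (root_perm c y) = state (d ^^ Suc k) [\<pi> r]"
      by (simp_all add: left_factor_def right_factor_def u k_def r_def orbit_rep_step[OF c] del: funpow.simps)
    have "inj (left_factor u (root_perm c y))"
      using bij_tree_auts[OF factor_auts(1)[OF uP]] by (simp add: bij_def)
    then show ?thesis unfolding lr'[symmetric] by simp
  next
    assume A: "orbit_pos c (root_perm c y) = 0 \<and>
      Suc (orbit_pos c y) = orbit_size c (orbit_rep c y)"
    then have lr': "left_factor u (root_perm c y) = id" "right_factor u (root_perm c y) = id"
      by (simp_all add: left_factor_def right_factor_def u flip: id_def)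
    have "Suc k = m" using A by (simp add: k_def m_def r_def)
    then show ?thesis
      using Suc.hyps(1)[OF len_z[symmetric] u'P] by (simp add: lr' u')
  qed
  then show ?case by (simp add: lhs rhs comm)
qed

text \<open>
  The defining recursion, written in the group: its factors are what functional recursiveness asks
  for.
\<close>

lemma state_conjugator:
  assumes "u \<in> P"
  shows "state (conjugator u) [y] =
    inv\<^bsub>Aut_T\<^esub> (left_factor u y) \<otimes>\<^bsub>Aut_T\<^esub> conjugator (follow u y) \<otimes>\<^bsub>Aut_T\<^esub> right_factor u y"
  using factor_auts[OF assms]
  by (simp add: state_def fun_eq_iff conjugator_Cons[OF assms] inv_Aut_T)

end

text \<open>
  The functionally recursive set consists of the conjugators of all vertices in \<open>P\<close>, not just the
  one for \<open>(a, b, \<pi>)\<close>, together with the states of \<open>a\<close> and \<open>b\<close> that the two factors are made of.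
\<close>

lemma successor_closed_conjugate:
  fixes a b :: "'x::{finite,linorder} list \<Rightarrow> 'x list"
  assumes aut: "a \<in> tree_auts" "b \<in> tree_auts"
    and fs: "finite_state a" "finite_state b"
    and fin: "finite (orbit_signalizer a)" "finite (orbit_signalizer b)"
    and P: "successor_closed a b P" and u: "(a, b, \<pi>) \<in> P"
  obtains h where "h \<in> carrier RAut_T" "h \<circ> a = b \<circ> h"
proof -
  have P_I: "P \<subseteq> verts (initial_graph a b)" using P by (simp add: successor_closed_def)
  have "\<forall>u x. \<exists>v. u \<in> P \<longrightarrow> x \<in> orbit_reps (fst u) \<longrightarrow>
      v \<in> P \<and> (fst v, fst (snd v)) = succ_pair u x"
    using P unfolding successor_closed_def by (metis fst_conv snd_conv prod.collapse)
  then obtain nxt where nxt: "\<And>u x. u \<in> P \<Longrightarrow> x \<in> orbit_reps (fst u) \<Longrightarrow>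
      nxt u x \<in> P \<and> (fst (nxt u x), fst (snd (nxt u x))) = succ_pair u x"
    by metis
  have sig: "c \<in> orbit_signalizer a \<and> d \<in> orbit_signalizer b \<and> \<pi> \<in> conj_perms c d"
    if "(c, d, \<pi>) \<in> P" for c d \<pi>
    using subsetD[OF P_I that] by (simp add: verts_initial_graph)
  interpret successor_choice P nxt
    by unfold_locales (use sig nxt aut orbit_signalizer_tree_auts in blast)+
  let ?S = "conjugator ` P \<union> range (state a) \<union> range (state b)"
  have incl: "generate Aut_T (range (state a)) \<subseteq> generate Aut_T ?S"
    "generate Aut_T (range (state b)) \<subseteq> generate Aut_T ?S"
    by (rule Aut_T.mono_generate; blast)+
  have S: "?S \<subseteq> tree_auts"
    using conjugator_tree_auts state_tree_auts aut by blast
  have "state (conjugator v) [x] \<in> generate Aut_T ?S" if v: "v \<in> P" for v x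
  proof -
    have "fst v \<in> orbit_signalizer a" "fst (snd v) \<in> orbit_signalizer b"
      using sig[of "fst v" "fst (snd v)" "snd (snd v)"] v by simp_all
    then have "left_factor v x \<in> generate Aut_T ?S" "right_factor v x \<in> generate Aut_T ?S"
      unfolding left_factor_def right_factor_def
      using orbit_signalizer_state_in_generate aut incl by blast+
    moreover have "conjugator (follow v x) \<in> generate Aut_T ?S"
      using follow_in[OF v] by (intro generate.incl) blast
    ultimately show ?thesis
      unfolding state_conjugator[OF v] using Aut_T.generate_m_inv_closed[of ?S] S
      by (intro generate.eng) simp_all
  qed
  moreover have "state (state a v) [x] \<in> generate Aut_T ?S"
    "state (state b v) [x] \<in> generate Aut_T ?S" for v x
    by (intro generate.incl, simp flip: state_append)+
  ultimately have "state g [x] \<in> generate Aut_T ?S" if "g \<in> ?S" for g x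
    using that by (elim UnE imageE) simp_all
  moreover have "finite ?S"
    using fs finite_subset[OF P_I finite_verts_initial_graph[OF fin]] by (simp add: finite_state_def)
  ultimately have "functionally_recursive_set ?S"
    unfolding functionally_recursive_set_iff by (intro conjI ballI allI S)
  then have "conjugator (a, b, \<pi>) \<in> carrier RAut_T"
    unfolding carrier_RAut_T using u by blast
  moreover have "conjugator (a, b, \<pi>) \<circ> a = b \<circ> conjugator (a, b, \<pi>)"
    using conjugator_intertwines[OF u] by (simp add: fun_eq_iff)
  ultimately show thesis by (rule that)
qed

theorem theorem2:
  fixes a b :: "'x::{finite,linorder} list \<Rightarrow> 'x list"
  assumes "a \<in> carrier Aut_T" and "b \<in> carrier Aut_T"
    and "finite_state a" and "finite_state b"
    and "finite (orbit_signalizer a)" and "finite (orbit_signalizer b)"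
  shows "(conjugate_in Aut_T a b \<longleftrightarrow> conjugate_in RAut_T a b) \<and>
         (conjugate_in RAut_T a b \<longleftrightarrow> (\<exists>\<pi>. (a, b, \<pi>) \<in> verts (conjugator_graph a b)))"
proof -
  have aut: "a \<in> tree_auts" "b \<in> tree_auts" using assms(1,2) by simp_all
  have R_Aut: "conjugate_in Aut_T a b" if "conjugate_in RAut_T a b"
    using that RAut_T_subset aut
    unfolding conjugate_in_Aut_T_iff conjugate_in_RAut_T_iff by blast
  have Aut_graph: "\<exists>\<pi>. (a, b, \<pi>) \<in> verts (conjugator_graph a b)" if conj: "conjugate_in Aut_T a b"
  proof -
    obtain h where "h \<in> tree_auts" "h \<circ> a = b \<circ> h"
      using conj unfolding conjugate_in_Aut_T_iff by blast
    then have "(a, b, root_perm h) \<in> verts (conjugator_graph a b)"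
      using orbit_signalizer_self[OF aut(1)] orbit_signalizer_self[OF aut(2)]
      by (intro subsetD[OF conjugator_graph_greatest(2)[OF aut assms(5,6)
            intertwiners_successor_closed[OF aut]]]) blast
    then show ?thesis by blast
  qed
  have graph_R: "conjugate_in RAut_T a b" if vertex: "(a, b, \<pi>) \<in> verts (conjugator_graph a b)" for \<pi>
  proof -
    obtain h where "h \<in> carrier RAut_T" "h \<circ> a = b \<circ> h"
      using successor_closed_conjugate[OF aut assms(3-6)
          conjugator_graph_greatest(1)[OF aut assms(5,6)] vertex] .
    then show ?thesis
      using finite_state_in_RAut_T aut assms(3,4) unfolding conjugate_in_RAut_T_iff by blast
  qed
  show ?thesis using R_Aut Aut_graph graph_R by blast
qed

end
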